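(* $q(4) = 9$, where for a positive integer $k$, $q(k)$ denotes the smallest integer $n$ such that there exists an intersecting $k$-family of transversal size $k$ and length $n$.
   Context: A $k$-set is a set with $k$ elements. A $k$-family is a collection of $k$-sets; its members are called blocks, and its length (or size) is the number of blocks in it. A $k$-family $\mathcal{F}$ is intersecting if $F \cap G \neq \emptyset$ for all $F, G \in \mathcal{F}$. A set $C$ is a covering set of $\mathcal{F}$ if $C \cap F \neq \emptyset$ for all $F \in \mathcal{F}$. The transversal size of $\mathcal{F}$ is the smallest integer $t$ such that there exists a covering set of $\mathcal{F}$ with exactly $t$ elements. *)

theory Defs
  imports Main
begin

definition k_set :: "nat \<Rightarrow> 'a set \<Rightarrow> bool" where
  "k_set k A \<longleftrightarrow> finite A \<and> card A = k"

definition k_family :: "nat \<Rightarrow> 'a set set \<Rightarrow> bool" where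
  "k_family k \<F> \<longleftrightarrow> (\<forall>F\<in>\<F>. k_set k F)"

definition has_length :: "'a set set \<Rightarrow> nat \<Rightarrow> bool" where
  "has_length \<F> n \<longleftrightarrow> finite \<F> \<and> card \<F> = n"

definition intersecting :: "'a set set \<Rightarrow> bool" where
  "intersecting \<F> \<longleftrightarrow> (\<forall>F\<in>\<F>. \<forall>G\<in>\<F>. F \<inter> G \<noteq> {})"

definition covering_set :: "'a set set \<Rightarrow> 'a set \<Rightarrow> bool" where
  "covering_set \<F> C \<longleftrightarrow> (\<forall>F\<in>\<F>. C \<inter> F \<noteq> {})"

definition transversal_size :: "'a set set \<Rightarrow> nat" where
  "transversal_size \<F> = (LEAST t. \<exists>C. k_set t C \<and> covering_set \<F> C)"

text \<open>Points are taken to be natural numbers. Since only families with finitely many finite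
  blocks are involved, this is no restriction; see \<open>q_witness_transfer\<close> below.\<close>

definition q :: "nat \<Rightarrow> nat" where
  "q k = (LEAST n. \<exists>\<F> :: nat set set. k_family k \<F> \<and> intersecting \<F> \<and>
            transversal_size \<F> = k \<and> has_length \<F> n)"

lemma transversal_size_le:
  assumes "finite C" "covering_set \<F> C"
  shows "transversal_size \<F> \<le> card C"
  unfolding transversal_size_def
  by (rule Least_le) (use assms in \<open>auto simp: k_set_def\<close>)

lemma transversal_size_witness:
  assumes "finite C" "covering_set \<F> C"
  obtains D where "finite D" "covering_set \<F> D" "card D = transversal_size \<F>"
proof -
  have "\<exists>D. k_set (transversal_size \<F>) D \<and> covering_set \<F> D"
    unfolding transversal_size_def
    by (rule LeastI[of _ "card C"]) (use assms in \<open>auto simp: k_set_def\<close>)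
  then show ?thesis using that by (auto simp: k_set_def)
qed

lemma q_witness_transfer:
  fixes \<F> :: "'a set set"
  assumes k: "0 < k" and fam: "k_family k \<F>" and int: "intersecting \<F>"
    and tr: "transversal_size \<F> = k" and len: "has_length \<F> n"
  shows "\<exists>\<G> :: nat set set. k_family k \<G> \<and> intersecting \<G> \<and>
           transversal_size \<G> = k \<and> has_length \<G> n"
proof -
  define U where "U = \<Union>\<F>"
  have finU: "finite U"
    using fam len by (auto simp: U_def k_family_def k_set_def has_length_def)
  then obtain h :: "'a \<Rightarrow> nat" where h: "inj_on h U"
    using finite_imp_inj_to_nat_seg by blast
  have sub: "F \<subseteq> U" if "F \<in> \<F>" for F using that by (auto simp: U_def)
  define \<G> where "\<G> = (`) h ` \<F>"
  have inj: "inj_on ((`) h) \<F>"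
    by (rule inj_on_subset[OF inj_on_image_Pow[OF h]]) (use sub in auto)
  have fam': "k_family k \<G>"
    unfolding k_family_def \<G>_def
  proof
    fix G assume "G \<in> (`) h ` \<F>"
    then obtain F where F: "F \<in> \<F>" "G = h ` F" by auto
    have "card G = card F" using F(2) card_image[OF inj_on_subset[OF h sub[OF F(1)]]] by simp
    then show "k_set k G" using fam F by (simp add: k_family_def k_set_def)
  qed
  have len': "has_length \<G> n"
    using len inj by (auto simp: \<G>_def has_length_def card_image)
  have int': "intersecting \<G>"
    using int by (fastforce simp: intersecting_def \<G>_def)
  have ne: "F \<noteq> {}" if "F \<in> \<F>" for F
    using that fam k by (auto simp: k_family_def k_set_def)
  have covU: "covering_set \<F> U"
    using sub ne by (simp add: covering_set_def Int_absorb1)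
  have covhU: "covering_set \<G> (h ` U)"
    using sub ne by (simp add: covering_set_def \<G>_def image_mono Int_absorb1)
  obtain C where C: "finite C" "covering_set \<F> C" "card C = transversal_size \<F>"
    using transversal_size_witness[OF finU covU] .
  have "covering_set \<G> (h ` C)"
    using C(2) by (fastforce simp: covering_set_def \<G>_def)
  then have le1: "transversal_size \<G> \<le> transversal_size \<F>"
    using transversal_size_le[of "h ` C" \<G>] C card_image_le[of C h] by simp
  obtain D where D: "finite D" "covering_set \<G> D" "card D = transversal_size \<G>"
    using transversal_size_witness[OF _ covhU] finU by auto
  define E where "E = {x\<in>U. h x \<in> D}"
  have "finite E" using finU by (simp add: E_def)
  moreover have "covering_set \<F> E"
    unfolding covering_set_def
  proof
    fix F assume F: "F \<in> \<F>"
    then have "D \<inter> h ` F \<noteq> {}" using D(2) by (auto simp: covering_set_def \<G>_def)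
    then show "E \<inter> F \<noteq> {}" using sub[OF F] by (auto simp: E_def)
  qed
  ultimately have "transversal_size \<F> \<le> card E" by (rule transversal_size_le)
  also have "card E \<le> card D"
    by (rule card_inj_on_le[of h]) (use h D in \<open>auto simp: E_def inj_on_def\<close>)
  finally have "transversal_size \<G> = k" using le1 D tr by simp
  with fam' int' len' show ?thesis by blast
qed

end

theory Submission
  imports Defs
begin

text \<open>Lower bound: two blocks of an intersecting family are met by one point, so \<open>2m\<close> blocks are
  covered by \<open>m\<close> points. Hence in a family of transversal size \<open>k\<close> the points of a set \<open>C\<close> that
  has at most one point on each block have degrees summing to at most \<open>n + 2 |C| + 1 - 2k\<close>, where
  \<open>n\<close> is the number of blocks. Applied to single points and compared with the degree sum along a
  block, this gives \<open>n \<ge> 2k\<close>. If \<open>n = 2k\<close>, all degrees are at most 3, each block carries at least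
  \<open>k - 1\<close> points of degree 3, and any two of these points share a block. Counting incidences and
  pairs, the number \<open>a\<close> of points of degree 3 satisfies
  \<open>a\<^sup>2 + 5a + 2k\<^sup>3 \<le> 6ka + 2k\<^sup>2\<close>, a quadratic inequality without solutions once \<open>k \<ge> 4\<close>.

  The 4-family of length 9 lives on a \<open>3 \<times> 3\<close> grid with two further points: one completes the
  rows, the other the columns, and the last three blocks are the symmetric differences of the first
  row with the columns. Three points that meet every row and every column and avoid one of the two
  apexes are the cells of a permutation, and these miss the symmetric difference belonging to the
  cell in the first row; three points including both apexes miss one of the last three blocks, as
  those have no common point.\<close>

section \<open>Degrees and uncovered blocks\<close>

definition degree :: "'a set set \<Rightarrow> 'a \<Rightarrow> nat" where
  "degree \<F> x = card {F\<in>\<F>. x \<in> F}"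

definition uncovered :: "'a set set \<Rightarrow> 'a set \<Rightarrow> 'a set set" where
  "uncovered \<F> C = {F\<in>\<F>. C \<inter> F = {}}"

lemma finite_uncovered: "finite \<F> \<Longrightarrow> finite (uncovered \<F> C)"
  by (simp add: uncovered_def)

lemma intersecting_uncovered: "intersecting \<F> \<Longrightarrow> intersecting (uncovered \<F> C)"
  by (auto simp: intersecting_def uncovered_def)

lemma covering_set_Un:
  assumes "covering_set (uncovered \<F> C) D"
  shows "covering_set \<F> (C \<union> D)"
  using assms by (fastforce simp: covering_set_def uncovered_def)

lemma intersecting_cover:
  assumes "finite \<F>" "intersecting \<F>"
  obtains C where "finite C" "covering_set \<F> C" "card C \<le> card \<F>"
proof
  let ?C = "(\<lambda>F. SOME x. x \<in> F) ` \<F>"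
  show "finite ?C" "card ?C \<le> card \<F>"
    using assms(1) by (auto intro: card_image_le)
  have "(SOME x. x \<in> F) \<in> F" if "F \<in> \<F>" for F
    using assms(2) that by (intro some_in_eq[THEN iffD2]) (auto simp: intersecting_def)
  then show "covering_set \<F> ?C"
    by (auto simp: covering_set_def)
qed

lemma transversal_size_le_uncovered:
  assumes "finite \<F>" "intersecting \<F>" "finite C"
  shows "transversal_size \<F> \<le> card C + transversal_size (uncovered \<F> C)"
proof -
  obtain E where "finite E" "covering_set (uncovered \<F> C) E"
    using intersecting_cover[OF finite_uncovered[OF assms(1)] intersecting_uncovered[OF assms(2)]] .
  then obtain D where D: "finite D" "covering_set (uncovered \<F> C) D"
      "card D = transversal_size (uncovered \<F> C)"
    by (rule transversal_size_witness)
  have "transversal_size \<F> \<le> card (C \<union> D)"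
    using assms(3) D(1) covering_set_Un[OF D(2)] by (intro transversal_size_le) auto
  also have "\<dots> \<le> card C + transversal_size (uncovered \<F> C)"
    using card_Un_le[of C D] D(3) by simp
  finally show ?thesis .
qed

lemma intersecting_transversal_size_le_half:
  assumes "finite \<F>" "intersecting \<F>"
  shows "2 * transversal_size \<F> \<le> card \<F> + 1"
  using assms
proof (induction "card \<F>" arbitrary: \<F> rule: less_induct)
  case less
  show ?case
  proof (cases "card \<F> \<le> 1")
    case True
    obtain C where "finite C" "covering_set \<F> C" "card C \<le> card \<F>"
      using intersecting_cover[OF less.prems] .
    then show ?thesis
      using True transversal_size_le[of C \<F>] by simp
  next
    case False
    then obtain F G where FG: "F \<in> \<F>" "G \<in> \<F>" "F \<noteq> G"
      using less.prems(1) by (auto simp: card_le_Suc0_iff_eq)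
    then obtain x where x: "x \<in> F" "x \<in> G"
      using less.prems(2) by (auto simp: intersecting_def)
    have "uncovered \<F> {x} \<subseteq> \<F> - {F, G}"
      using x by (auto simp: uncovered_def)
    then have "card (uncovered \<F> {x}) \<le> card (\<F> - {F, G})"
      using less.prems(1) by (intro card_mono) auto
    also have "\<dots> = card \<F> - 2"
      using FG by (simp add: card_Diff_subset)
    finally have fewer: "card (uncovered \<F> {x}) + 2 \<le> card \<F>"
      using False by simp
    then have "2 * transversal_size (uncovered \<F> {x}) \<le> card (uncovered \<F> {x}) + 1"
      using less.prems by (intro less.hyps finite_uncovered intersecting_uncovered) auto
    then show ?thesis
      using fewer transversal_size_le_uncovered[OF less.prems, of "{x}"] by simp
  qed
qed

lemma sum_degree:
  assumes "finite \<F>" "finite A"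
  shows "(\<Sum>x\<in>A. degree \<F> x) = (\<Sum>F\<in>\<F>. card (A \<inter> F))"
  unfolding degree_def using assms by (intro sum_multicount_gen) (auto simp: Int_def)

lemma sum_degree_scattered_le:
  assumes fin: "finite \<F>" and int: "intersecting \<F>" and C: "finite C"
    and scattered: "\<And>F. F \<in> \<F> \<Longrightarrow> card (C \<inter> F) \<le> 1"
  shows "2 * transversal_size \<F> + (\<Sum>x\<in>C. degree \<F> x) \<le> card \<F> + 2 * card C + 1"
proof -
  have "(\<Sum>x\<in>C. degree \<F> x) = (\<Sum>F\<in>\<F>. card (C \<inter> F))"
    by (rule sum_degree[OF fin C])
  also have "\<dots> = (\<Sum>F\<in>\<F> - uncovered \<F> C. card (C \<inter> F))"
    using fin by (intro sum.mono_neutral_right) (auto simp: uncovered_def)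
  also have "\<dots> \<le> (\<Sum>F\<in>\<F> - uncovered \<F> C. 1)"
    by (intro sum_mono scattered) simp
  finally have "(\<Sum>x\<in>C. degree \<F> x) + card (uncovered \<F> C) \<le> card \<F>"
    using fin finite_uncovered[OF fin] card_mono[OF fin, of "uncovered \<F> C"]
    by (simp add: card_Diff_subset uncovered_def)
  moreover have "2 * transversal_size (uncovered \<F> C) \<le> card (uncovered \<F> C) + 1"
    using fin int
    by (intro intersecting_transversal_size_le_half finite_uncovered intersecting_uncovered)
  ultimately show ?thesis
    using transversal_size_le_uncovered[OF fin int C] by linarith
qed

lemma degree_le:
  assumes "finite \<F>" "intersecting \<F>"
  shows "2 * transversal_size \<F> + degree \<F> x \<le> card \<F> + 3"
proof -
  have "card ({x} \<inter> F) \<le> 1" for F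
    by (simp add: Int_insert_left)
  from sum_degree_scattered_le[OF assms _ this] show ?thesis
    by simp
qed

lemma ex_common_block:
  assumes "finite \<F>" "intersecting \<F>" "x \<noteq> y"
    and "card \<F> + 5 < 2 * transversal_size \<F> + degree \<F> x + degree \<F> y"
  shows "\<exists>F\<in>\<F>. x \<in> F \<and> y \<in> F"
proof (rule ccontr)
  assume "\<not> (\<exists>F\<in>\<F>. x \<in> F \<and> y \<in> F)"
  then have "card ({x, y} \<inter> F) \<le> 1" if "F \<in> \<F>" for F
    using that by (auto simp: Int_insert_left)
  from sum_degree_scattered_le[OF assms(1,2) _ this] show False
    using assms(3,4) by simp
qed

lemma sum_degree_block_ge:
  assumes "finite \<F>" "intersecting \<F>" "F \<in> \<F>" "finite F"
  shows "card F + card \<F> \<le> (\<Sum>x\<in>F. degree \<F> x) + 1"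
proof -
  have "1 \<le> card (F \<inter> G)" if "G \<in> \<F> - {F}" for G
    using assms that by (auto simp: intersecting_def Suc_le_eq card_gt_0_iff)
  then have "(\<Sum>G\<in>\<F> - {F}. 1) \<le> (\<Sum>G\<in>\<F> - {F}. card (F \<inter> G))"
    by (rule sum_mono)
  moreover have "(\<Sum>x\<in>F. degree \<F> x) = card F + (\<Sum>G\<in>\<F> - {F}. card (F \<inter> G))"
    using assms by (simp add: sum_degree sum.remove[of \<F> F])
  moreover have "card \<F> = Suc (card (\<F> - {F}))"
    using assms(1,3) by (rule card.remove)
  ultimately show ?thesis by simp
qed

lemma card_ordered_pairs_le:
  assumes "finite \<F>" "finite A"
    and joined: "\<And>x y. x \<in> A \<Longrightarrow> y \<in> A \<Longrightarrow> x \<noteq> y \<Longrightarrow> \<exists>F\<in>\<F>. x \<in> F \<and> y \<in> F"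
  shows "card A * (card A - 1) \<le> (\<Sum>F\<in>\<F>. card (A \<inter> F) * (card (A \<inter> F) - 1))"
proof -
  define pairs where "pairs B = (SIGMA x : B. B - {x})" for B :: "'a set"
  have card_pairs: "card (pairs B) = card B * (card B - 1)" if "finite B" for B
    using that by (simp add: pairs_def)
  have fin: "finite (A \<inter> F)" for F using assms(2) by simp
  have "card (pairs A) \<le> card (\<Union>F\<in>\<F>. pairs (A \<inter> F))"
    using assms(1) fin joined by (intro card_mono) (fastforce simp: pairs_def)+
  also have "\<dots> \<le> (\<Sum>F\<in>\<F>. card (pairs (A \<inter> F)))"
    by (rule card_UN_le[OF assms(1)])
  finally show ?thesis by (simp add: card_pairs fin assms(2))
qed

section \<open>Families of at most \<open>2k\<close> blocks\<close>

lemma card_ge_twice_transversal_size: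
  assumes k: "3 \<le> k" and fam: "k_family k \<F>" and fin: "finite \<F>" and int: "intersecting \<F>"
    and tr: "transversal_size \<F> = k"
  shows "2 * k \<le> card \<F>"
proof (rule ccontr)
  assume "\<not> 2 * k \<le> card \<F>"
  then obtain d where d: "2 * k = Suc (card \<F> + d)"
    by (auto simp: not_le less_iff_Suc_add)
  have "\<F> \<noteq> {}"
    using transversal_size_le[of "{}" \<F>] tr k by (auto simp: covering_set_def)
  then obtain F where F: "F \<in> \<F>" by blast
  then have block: "finite F" "card F = k"
    using fam by (auto simp: k_family_def k_set_def)
  have "degree \<F> x + d \<le> 2" for x
    using degree_le[OF fin int, of x] tr d by simp
  then have "(\<Sum>x\<in>F. degree \<F> x) + k * d \<le> 2 * k"
    using sum_bounded_above[of F "\<lambda>x. degree \<F> x + d" 2] block by (simp add: sum.distrib)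
  moreover have "k + card \<F> \<le> (\<Sum>x\<in>F. degree \<F> x) + 1"
    using sum_degree_block_ge[OF fin int F] block by simp
  moreover have "3 * d \<le> k * d" using k by simp
  ultimately show False using d k by linarith
qed

lemma sum_le_card_max:
  fixes f :: "'a \<Rightarrow> nat"
  assumes "finite A" "\<And>x. x \<in> A \<Longrightarrow> f x \<le> Suc d"
  shows "(\<Sum>x\<in>A. f x) \<le> d * card A + card {x\<in>A. f x = Suc d}"
proof -
  have "(\<Sum>x\<in>A. f x) \<le> (\<Sum>x\<in>A. d + (if f x = Suc d then 1 else 0))"
    using assms(2) by (intro sum_mono) (auto simp: le_Suc_eq)
  also have "\<dots> = d * card A + card {x\<in>A. f x = Suc d}"
    using assms(1) by (simp add: sum.distrib sum.If_cases Int_def)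
  finally show ?thesis .
qed

lemma card_degree_3_block:
  assumes fin: "finite \<F>" and int: "intersecting \<F>" and F: "F \<in> \<F>" "k_set k F"
    and tr: "transversal_size \<F> = k" and card: "card \<F> = 2 * k"
  shows "card {x\<in>F. degree \<F> x = 3} = k \<or> Suc (card {x\<in>F. degree \<F> x = 3}) = k"
proof -
  have block: "finite F" "card F = k" using F(2) by (auto simp: k_set_def)
  have "degree \<F> x \<le> Suc 2" for x
    using degree_le[OF fin int, of x] tr card by simp
  from sum_le_card_max[OF block(1) this]
  have "(\<Sum>x\<in>F. degree \<F> x) \<le> 2 * k + card {x\<in>F. degree \<F> x = 3}"
    using block by simp
  then have "k \<le> card {x\<in>F. degree \<F> x = 3} + 1"
    using sum_degree_block_ge[OF fin int F(1)] block card by simp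
  moreover have "card {x\<in>F. degree \<F> x = 3} \<le> k"
    using card_mono[OF block(1), of "{x\<in>F. degree \<F> x = 3}"] block by auto
  ultimately show ?thesis by linarith
qed

lemma degree_3_points_inequality:
  assumes fam: "k_family k \<F>" and fin: "finite \<F>" and int: "intersecting \<F>"
    and tr: "transversal_size \<F> = k" and card: "card \<F> = 2 * k"
  defines "a \<equiv> card {x\<in>\<Union>\<F>. degree \<F> x = 3}"
  shows "a\<^sup>2 + 5 * a + 2 * k ^ 3 \<le> 6 * k * a + 2 * k\<^sup>2"
proof -
  define A where "A = {x\<in>\<Union>\<F>. degree \<F> x = 3}"
  have finA: "finite A" using fin fam by (auto simp: A_def k_family_def k_set_def)
  define m where "m F = card (A \<inter> F)" for F
  have m_eq: "m F * (m F - 1) + 2 * m F + k\<^sup>2 = 2 * k * m F + k" if F: "F \<in> \<F>" for F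
  proof -
    have "A \<inter> F = {x\<in>F. degree \<F> x = 3}" using F by (auto simp: A_def)
    then consider "m F = k" | "k = Suc (m F)"
      using card_degree_3_block[OF fin int F _ tr card] F fam
      by (auto simp: m_def k_family_def)
    then show ?thesis by cases (cases "m F"; simp add: power2_eq_square algebra_simps)+
  qed
  have sum_m: "(\<Sum>F\<in>\<F>. m F) = 3 * a"
    using sum_degree[OF fin finA] by (simp add: m_def a_def A_def)
  have "\<exists>F\<in>\<F>. x \<in> F \<and> y \<in> F" if "x \<in> A" "y \<in> A" "x \<noteq> y" for x y
    using ex_common_block[OF fin int that(3)] that(1,2) tr card by (simp add: A_def)
  from card_ordered_pairs_le[OF fin finA this]
  have pairs: "a * (a - 1) \<le> (\<Sum>F\<in>\<F>. m F * (m F - 1))"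
    unfolding a_def A_def m_def .
  have "(\<Sum>F\<in>\<F>. m F * (m F - 1)) + 2 * (\<Sum>F\<in>\<F>. m F) + (\<Sum>F\<in>\<F>. k\<^sup>2) =
      (\<Sum>F\<in>\<F>. m F * (m F - 1) + 2 * m F + k\<^sup>2)"
    by (simp only: sum.distrib sum_distrib_left)
  also have "\<dots> = (\<Sum>F\<in>\<F>. 2 * k * m F + k)"
    by (rule sum.cong[OF refl m_eq])
  also have "\<dots> = 2 * k * (\<Sum>F\<in>\<F>. m F) + (\<Sum>F\<in>\<F>. k)"
    by (simp only: sum.distrib sum_distrib_left)
  finally have "a * (a - 1) + 6 * a + 2 * k * k\<^sup>2 \<le> 6 * k * a + 2 * k * k"
    using pairs by (simp add: sum_m card)
  moreover have "a * (a - 1) + 6 * a = a\<^sup>2 + 5 * a"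
    by (cases a) (simp_all add: power2_eq_square)
  ultimately show ?thesis
    by (simp add: power2_eq_square power3_eq_cube)
qed

lemma degree_3_points_inequality_unsolvable:
  fixes a k :: nat
  assumes "4 \<le> k"
  shows "6 * k * a + 2 * k\<^sup>2 < a\<^sup>2 + 5 * a + 2 * k ^ 3"
proof -
  obtain j where k: "k = 4 + j" using le_Suc_ex[OF assms] by blast
  have "4 * (int (a\<^sup>2 + 5 * a + 2 * k ^ 3) - int (6 * k * a + 2 * k\<^sup>2)) =
      (2 * int a + 5 - 6 * int k)\<^sup>2 + (8 * int j ^ 3 + 52 * (int j)\<^sup>2 + 92 * int j + 23)"
    by (simp add: k power2_eq_square power3_eq_cube algebra_simps)
  moreover have "0 < (2 * int a + 5 - 6 * int k)\<^sup>2 +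
      (8 * int j ^ 3 + 52 * (int j)\<^sup>2 + 92 * int j + 23)"
    by (simp add: add_nonneg_pos)
  ultimately have "0 < 4 * (int (a\<^sup>2 + 5 * a + 2 * k ^ 3) - int (6 * k * a + 2 * k\<^sup>2))"
    by (simp only:)
  then show ?thesis
    by (simp only: zero_less_mult_iff diff_gt_0_iff_gt of_nat_less_iff) simp
qed

theorem card_gt_twice_transversal_size:
  assumes "4 \<le> k" "k_family k \<F>" "finite \<F>" "intersecting \<F>" "transversal_size \<F> = k"
  shows "2 * k < card \<F>"
proof -
  have "2 * k \<le> card \<F>"
    using assms by (intro card_ge_twice_transversal_size) auto
  moreover have "card \<F> \<noteq> 2 * k"
    using degree_3_points_inequality[OF assms(2-5)]
      degree_3_points_inequality_unsolvable[OF assms(1)] by (auto simp: not_le[symmetric])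
  ultimately show ?thesis by simp
qed

section \<open>A 4-family of length 9\<close>

datatype point = Cell nat nat | Row_Apex | Column_Apex

definition row :: "nat \<Rightarrow> point set" where
  "row i = {Cell i 0, Cell i 1, Cell i 2, Row_Apex}"

definition column :: "nat \<Rightarrow> point set" where
  "column j = {Cell 0 j, Cell 1 j, Cell 2 j, Column_Apex}"

definition bend :: "nat \<Rightarrow> point set" where
  "bend j = Cell 0 ` ({0, 1, 2} - {j}) \<union> {Cell 1 j, Cell 2 j}"

definition grid_family :: "point set set" where
  "grid_family = row ` {0, 1, 2} \<union> column ` {0, 1, 2} \<union> bend ` {0, 1, 2}"

lemmas grid_family_defs = grid_family_def row_def column_def bend_def

lemma k_family_grid_family: "k_family 4 grid_family"
  by (simp add: grid_family_defs k_family_def k_set_def insert_Diff_if)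

lemma intersecting_grid_family: "intersecting grid_family"
  by (simp add: grid_family_defs intersecting_def insert_Diff_if)

lemma has_length_grid_family: "has_length grid_family 9"
proof -
  have "Cell i 0 \<in> row j \<longleftrightarrow> i = j" "Cell 0 i \<in> column j \<longleftrightarrow> i = j"
    "Cell 1 i \<in> bend j \<longleftrightarrow> i = j" for i j
    by (auto simp: row_def column_def bend_def)
  then have "inj row" "inj column" "inj bend"
    by (metis injI)+
  moreover have "card (f ` {0, 1, 2}) = 3" if "inj f" for f :: "nat \<Rightarrow> point set"
    using card_image[OF inj_on_subset[OF that subset_UNIV], of "{0, 1, 2}"] by simp
  moreover have "row ` {0, 1, 2} \<inter> column ` {0, 1, 2} = {}"
    "(row ` {0, 1, 2} \<union> column ` {0, 1, 2}) \<inter> bend ` {0, 1, 2} = {}"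
    by (auto simp: row_def column_def bend_def)
  ultimately show ?thesis
    by (simp add: has_length_def grid_family_def card_Un_disjoint del: image_insert)
qed

lemma cover_grid_family_meets:
  assumes "covering_set grid_family C" "i \<in> {0, 1, 2}"
  shows "\<exists>x\<in>C. x \<in> row i" "\<exists>x\<in>C. x \<in> column i" "\<exists>x\<in>C. x \<in> bend i"
  using assms by (auto simp only: covering_set_def grid_family_def)

lemma Row_Apex_in_small_cover:
  assumes fin: "finite C" and cov: "covering_set grid_family C" and card: "card C \<le> 3"
  shows "Row_Apex \<in> C"
proof (rule ccontr)
  assume "Row_Apex \<notin> C"
  then have "\<exists>j\<in>{0, 1, 2}. Cell i j \<in> C" if "i \<in> {0, 1, 2}" for i
    using cover_grid_family_meets(1)[OF cov that] by (auto simp: row_def)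
  then obtain a b c where "{Cell 0 a, Cell 1 b, Cell 2 c} \<subseteq> C" and a: "a \<in> {0, 1, 2}"
    by (metis empty_subsetI insert_subset insertCI)
  then have C: "C = {Cell 0 a, Cell 1 b, Cell 2 c}"
    using card by (intro card_seteq[symmetric] fin) auto
  have "j \<in> {a, b, c}" if "j \<in> {0, 1, 2}" for j
    using cover_grid_family_meets(2)[OF cov that] by (auto simp: C column_def)
  moreover have "a \<in> {b, c}"
    using cover_grid_family_meets(3)[OF cov a] by (auto simp: C bend_def)
  ultimately have "{0, 1, 2} \<subseteq> {b, c}" by blast
  from card_mono[OF _ this] show False by (simp add: card_insert_if split: if_splits)
qed

lemma Column_Apex_in_small_cover:
  assumes fin: "finite C" and cov: "covering_set grid_family C" and card: "card C \<le> 3"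
  shows "Column_Apex \<in> C"
proof (rule ccontr)
  assume "Column_Apex \<notin> C"
  then have "\<exists>i. Cell i j \<in> C" if "j \<in> {0, 1, 2}" for j
    using cover_grid_family_meets(2)[OF cov that] by (auto simp: column_def)
  then obtain a b c where "{Cell a 0, Cell b 1, Cell c 2} \<subseteq> C"
    by (metis empty_subsetI insert_subset insertCI)
  then have "{Cell a 0, Cell b 1, Cell c 2, Row_Apex} \<subseteq> C"
    using Row_Apex_in_small_cover[OF assms] by simp
  from card_mono[OF fin this] show False
    using card by simp
qed

lemma card_cover_grid_family_ge:
  assumes fin: "finite C" and cov: "covering_set grid_family C"
  shows "4 \<le> card C"
proof (rule ccontr)
  assume "\<not> 4 \<le> card C"
  then have card: "card C \<le> 3" by simp
  have "card (C - {Row_Apex, Column_Apex}) \<le> 1"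
    using Row_Apex_in_small_cover[OF fin cov card] Column_Apex_in_small_cover[OF fin cov card] card
    by (simp add: card_Diff_subset)
  then obtain p where p: "C - {Row_Apex, Column_Apex} \<subseteq> {p}"
    using fin by (metis card_le_Suc0_iff_eq finite_Diff One_nat_def singletonI subsetI)
  then have "p \<in> bend j" if "j \<in> {0, 1, 2}" for j
    using cover_grid_family_meets(3)[OF cov that] by (auto simp: bend_def)
  then have "p \<in> bend 0 \<inter> bend 1 \<inter> bend 2" by simp
  then show False by (auto simp: bend_def insert_Diff_if)
qed

lemma transversal_size_grid_family: "transversal_size grid_family = 4"
proof (rule antisym)
  have cov: "covering_set grid_family (row 0)"
    using intersecting_grid_family by (simp add: intersecting_def covering_set_def grid_family_def)
  have row: "finite (row 0)" "card (row 0) = 4"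
    by (simp_all add: row_def)
  show "transversal_size grid_family \<le> 4"
    using transversal_size_le[OF row(1) cov] row(2) by simp
  obtain C where "finite C" "covering_set grid_family C" "card C = transversal_size grid_family"
    using transversal_size_witness[OF row(1) cov] .
  then show "4 \<le> transversal_size grid_family"
    using card_cover_grid_family_ge[of C] by simp
qed

theorem theorem2p1: "q 4 = 9"
  unfolding q_def
proof (rule Least_equality)
  show "\<exists>\<F> :: nat set set. k_family 4 \<F> \<and> intersecting \<F> \<and> transversal_size \<F> = 4 \<and>
      has_length \<F> 9"
    by (rule q_witness_transfer[OF _ k_family_grid_family intersecting_grid_family
          transversal_size_grid_family has_length_grid_family]) simp
next
  fix n
  assume "\<exists>\<F> :: nat set set. k_family 4 \<F> \<and> intersecting \<F> \<and> transversal_size \<F> = 4 \<and>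
      has_length \<F> n"
  then obtain \<F> :: "nat set set" where "k_family 4 \<F>" "intersecting \<F>"
      "transversal_size \<F> = 4" "has_length \<F> n"
    by blast
  then show "9 \<le> n"
    using card_gt_twice_transversal_size[of 4 \<F>] by (simp add: has_length_def)
qed

end
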